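(* Let $m\ge1$, $\lambda\in\mathbb{C}\setminus\{0\}$, and let $(\mathcal{H}^m_\lambda,[\cdot,\cdot],\alpha)$ be a $(2m+1)$-dimensional Heisenberg Hom-Lie algebra over $\mathbb{C}$ such that $\alpha$ acts on the line $[\mathcal{H}^m_\lambda,\mathcal{H}^m_\lambda]$ as multiplication by $\lambda$. Let $k$ be the exponent of $(x-\lambda)$ in the minimal polynomial of $\alpha$. If $\lambda\ne1$ or $k=1$, then there is a basis $(x_1,\dots,x_m,y_1,\dots,y_m,z)$ of $\mathcal{H}^m_\lambda$ such that $[x_i,y_j]=\delta_{ij}z$, $[x_i,x_j]=[y_i,y_j]=0$ for all $i,j$, $z$ is central, and the matrix of $\alpha$ in this basis is of the form $$P=\begin{bmatrix}X&T&0\\0&Y&0\\0&M&\lambda\end{bmatrix}$$ with $X,T,Y\in M_m(\mathbb{C})$, $M\in M_{1,m}(\mathbb{C})$, ${}^tX\,Y=\lambda I_m$ and ${}^tT\,Y={}^tY\,T$.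
   Context: Matrices of linear maps act on column vectors (columns are images of basis vectors). A Hom-Lie algebra is a triple $(\mathcal{G},[\cdot,\cdot],\alpha)$ with $[\cdot,\cdot]$ skew-symmetric bilinear on the vector space $\mathcal{G}$ and $\alpha:\mathcal{G}\to\mathcal{G}$ linear, such that $[\alpha(x),[y,w]]+[\alpha(y),[w,x]]+[\alpha(w),[x,y]]=0$ for all $x,y,w$. It is multiplicative if $\alpha([x,y])=[\alpha(x),\alpha(y)]$. Its center is $Z(\mathcal{G})=\{x:[x,y]=0\ \forall y\}$; it is nilpotent if the series $\mathcal{G}_0=\mathcal{G}$, $\mathcal{G}_{n+1}=[\mathcal{G},\mathcal{G}_n]$ reaches $\{0\}$. A Heisenberg Hom-Lie algebra is a multiplicative nilpotent Hom-Lie algebra $\mathcal{H}$ with $\dim[\mathcal{H},\mathcal{H}]=1$ and $[\mathcal{H},\mathcal{H}]=Z(\mathcal{H})$. *)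

theory Defs
  imports
    Complex_Main
    "HOL-Computational_Algebra.Polynomial"
    "Jordan_Normal_Form.Matrix"
begin

definition ordered_basis :: "('a::field \<Rightarrow> 'b::ab_group_add \<Rightarrow> 'b) \<Rightarrow> 'b list \<Rightarrow> bool" where
  "ordered_basis scale bs \<longleftrightarrow>
     distinct bs \<and> \<not> module.dependent scale (set bs) \<and> module.span scale (set bs) = UNIV"

text \<open>Column \<open>j\<close> holds the coordinates of \<open>f (bs ! j)\<close>; meaningful when \<open>bs\<close> is an ordered basis.\<close>

definition matrix_of_map ::
  "('a::field \<Rightarrow> 'b::ab_group_add \<Rightarrow> 'b) \<Rightarrow> 'b list \<Rightarrow> ('b \<Rightarrow> 'b) \<Rightarrow> 'a mat" where
  "matrix_of_map scale bs f =
     mat (length bs) (length bs)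
       (\<lambda>(i, j). module.representation scale (set bs) (f (bs ! j)) (bs ! i))"

text \<open>The value \<open>p(f)\<close> of a polynomial at an endomorphism, applied to \<open>v\<close>.\<close>

definition poly_of_map ::
  "('a::field \<Rightarrow> 'b::ab_group_add \<Rightarrow> 'b) \<Rightarrow> 'a poly \<Rightarrow> ('b \<Rightarrow> 'b) \<Rightarrow> 'b \<Rightarrow> 'b" where
  "poly_of_map scale p f v = (\<Sum>i\<le>degree p. scale (coeff p i) ((f ^^ i) v))"

definition minimal_polynomial ::
  "('a::field \<Rightarrow> 'b::ab_group_add \<Rightarrow> 'b) \<Rightarrow> ('b \<Rightarrow> 'b) \<Rightarrow> 'a poly \<Rightarrow> bool" where
  "minimal_polynomial scale f p \<longleftrightarrow>
     lead_coeff p = 1 \<and> (\<forall>v. poly_of_map scale p f v = 0) \<and>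
     (\<forall>q. q \<noteq> 0 \<longrightarrow> (\<forall>v. poly_of_map scale q f v = 0) \<longrightarrow> degree p \<le> degree q)"

text \<open>The skew-symmetry is stated as \<open>[x, y] = - [y, x]\<close>, which in characteristic two does not give
  \<open>[x, x] = 0\<close>.\<close>

locale hom_lie_algebra = vector_space scale
  for scale :: "'a::field \<Rightarrow> 'b::ab_group_add \<Rightarrow> 'b" +
  fixes br :: "'b \<Rightarrow> 'b \<Rightarrow> 'b" and \<alpha> :: "'b \<Rightarrow> 'b"
  assumes linear_br_left: "Vector_Spaces.linear scale scale (\<lambda>x. br x y)"
    and linear_br_right: "Vector_Spaces.linear scale scale (\<lambda>y. br x y)"
    and br_skew: "br x y = - br y x"
    and linear_twist: "Vector_Spaces.linear scale scale \<alpha>"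
    and hom_jacobi: "br (\<alpha> x) (br y w) + br (\<alpha> y) (br w x) + br (\<alpha> w) (br x y) = 0"
begin

definition multiplicative :: bool where
  "multiplicative \<longleftrightarrow> (\<forall>x y. \<alpha> (br x y) = br (\<alpha> x) (\<alpha> y))"

definition center :: "'b set" where
  "center = {x. \<forall>y. br x y = 0}"

definition bracket :: "'b set \<Rightarrow> 'b set \<Rightarrow> 'b set" where
  "bracket A B = span {br a b | a b. a \<in> A \<and> b \<in> B}"

primrec lower_central :: "nat \<Rightarrow> 'b set" where
  "lower_central 0 = UNIV"
| "lower_central (Suc n) = bracket UNIV (lower_central n)"

definition nilpotent :: bool where
  "nilpotent \<longleftrightarrow> (\<exists>n. lower_central n = {0})"

end

locale heisenberg_hom_lie_algebra = hom_lie_algebra +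
  assumes multiplicative: multiplicative
    and nilpotent: nilpotent
    and dim_derived: "dim (bracket UNIV UNIV) = 1"
    and derived_eq_center: "bracket UNIV UNIV = center"

text \<open>The block matrix \<open>[X T 0; 0 Y 0; 0 M c]\<close> with \<open>X\<close>, \<open>T\<close>, \<open>Y\<close> of size \<open>m \<times> m\<close> and \<open>M\<close> of size
  \<open>1 \<times> m\<close>, assembled as \<open>[X, [T 0]; 0, [Y 0; M c]]\<close>. The row \<open>[T 0]\<close> is a four-block matrix whose
  lower blocks have no rows.\<close>

definition heisenberg_block_mat ::
  "nat \<Rightarrow> 'a::zero mat \<Rightarrow> 'a mat \<Rightarrow> 'a mat \<Rightarrow> 'a mat \<Rightarrow> 'a \<Rightarrow> 'a mat" where
  "heisenberg_block_mat m X T Y M c =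
     four_block_mat
       X                (four_block_mat T (0\<^sub>m m 1) (0\<^sub>m 0 m) (0\<^sub>m 0 1))
       (0\<^sub>m (m + 1) m)  (four_block_mat Y (0\<^sub>m m 1) M (mat 1 1 (\<lambda>_. c)))"

end

theory Submission
  imports
    Defs
    "HOL-Computational_Algebra.Fundamental_Theorem_Algebra"
begin

text \<open>
  The bracket is \<open>[u, v] = \<omega>(u, v) z\<close> for an alternating form \<open>\<omega>\<close> with radical \<open>\<langle>z\<rangle>\<close> satisfying
  \<open>\<omega>(\<alpha> u, \<alpha> v) = c \<omega>(u, v)\<close>. Take a hyperbolic system \<open>x\<^sub>i, y\<^sub>i\<close> of maximal length whose \<open>x\<^sub>i\<close> span
  an \<open>\<alpha>\<close>-invariant subspace \<open>L\<close>, and let \<open>S = L\<^sup>\<bottom> \<supseteq> B = L + \<langle>z\<rangle>\<close>. An eigenvector of \<open>\<alpha>\<close> on \<open>S / L\<close>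
  outside \<open>B / L\<close> would extend the system. If \<open>S \<noteq> B\<close>, an eigenvector \<open>w\<close> on \<open>S / B\<close> therefore has
  eigenvalue \<open>c\<close>, since for any other eigenvalue a multiple of \<open>z\<close> corrects it to one on \<open>S / L\<close>.
  As \<open>\<omega>(w, \<alpha> u) = \<omega>(w, u)\<close> for \<open>u \<in> S\<close>, the number \<open>1\<close> is an eigenvalue of the dual map, hence
  of \<open>\<alpha>\<close> on \<open>S / B\<close>, so \<open>c = 1\<close>. Then \<open>k = 1\<close> makes \<open>c\<close> a semisimple eigenvalue, which turns \<open>w\<close>
  into an eigenvector on \<open>S / L\<close> after all. So \<open>S = B\<close>, and the system together with \<open>z\<close> is a basis.
\<close>

section \<open>Polynomials in an endomorphism\<close>

context vector_space
begin

lemma subspace_scale_cancel: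
  assumes "subspace S" and "a *s v \<in> S" and "a \<noteq> 0"
  shows "v \<in> S"
  using subspace_scale[OF assms(1,2), of "inverse a"] assms(3) by simp

text \<open>A common summation bound lets polynomials of different degrees be compared term by
  term.\<close>

lemma poly_of_map_eq_sum:
  assumes "degree p \<le> n"
  shows "poly_of_map scale p f v = (\<Sum>i\<le>n. coeff p i *s (f ^^ i) v)"
  unfolding poly_of_map_def
  by (rule sum.mono_neutral_left) (use assms in \<open>auto simp: coeff_eq_0\<close>)

lemma poly_of_map_0 [simp]: "poly_of_map scale 0 f v = 0"
  by (simp add: poly_of_map_def)

lemma poly_of_map_add:
  "poly_of_map scale (p + q) f v = poly_of_map scale p f v + poly_of_map scale q f v"
proof -
  define n where "n = max (degree p) (degree q)"
  have "degree p \<le> n" "degree q \<le> n" "degree (p + q) \<le> n"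
    by (auto simp: n_def intro: degree_add_le_max)
  then show ?thesis
    by (simp add: poly_of_map_eq_sum[of _ n] scale_left_distrib sum.distrib)
qed

lemma poly_of_map_smult:
  "poly_of_map scale (Polynomial.smult a p) f v = a *s poly_of_map scale p f v"
  by (simp add: poly_of_map_eq_sum[OF degree_smult_le] poly_of_map_eq_sum[OF order_refl]
      scale_sum_right)

text \<open>Horner's recursion, the step of most inductions on the polynomial below.\<close>

lemma poly_of_map_pCons:
  assumes "Vector_Spaces.linear scale scale f"
  shows "poly_of_map scale (pCons a p) f v = a *s v + f (poly_of_map scale p f v)"
proof -
  interpret f: Vector_Spaces.linear scale scale f by fact
  show ?thesis
    by (simp add: poly_of_map_eq_sum[OF degree_pCons_le] poly_of_map_eq_sum[OF order_refl]
        sum.atMost_Suc_shift f.sum f.scale del: sum.atMost_Suc)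
qed

lemma poly_of_map_root_mult:
  assumes "Vector_Spaces.linear scale scale f"
  shows "poly_of_map scale ([:- t, 1:] * r) f v
    = f (poly_of_map scale r f v) - t *s poly_of_map scale r f v"
proof -
  have "[:- t, 1:] * r = Polynomial.smult (- t) r + pCons 0 r" by simp
  then show ?thesis
    by (simp only: poly_of_map_add poly_of_map_smult poly_of_map_pCons[OF assms]) simp
qed

lemma poly_of_map_in_subspace:
  assumes "Vector_Spaces.linear scale scale f" and "subspace B" and "\<And>u. u \<in> B \<Longrightarrow> f u \<in> B"
    and "v \<in> B"
  shows "poly_of_map scale p f v \<in> B"
  by (induction p) (use assms in \<open>simp_all add: poly_of_map_pCons subspace_0 subspace_add subspace_scale\<close>)

lemma poly_of_map_vec_add:
  assumes "Vector_Spaces.linear scale scale f"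
  shows "poly_of_map scale p f (u + v) = poly_of_map scale p f u + poly_of_map scale p f v"
proof -
  interpret f: Vector_Spaces.linear scale scale f by fact
  show ?thesis
    by (induction p) (simp_all add: poly_of_map_pCons[OF assms] f.add scale_right_distrib)
qed

lemma poly_of_map_vec_scale:
  assumes "Vector_Spaces.linear scale scale f"
  shows "poly_of_map scale p f (a *s v) = a *s poly_of_map scale p f v"
proof -
  interpret f: Vector_Spaces.linear scale scale f by fact
  show ?thesis
    by (induction p) (simp_all add: poly_of_map_pCons[OF assms] f.scale scale_right_distrib mult.commute)
qed

lemma poly_of_map_commute:
  assumes "Vector_Spaces.linear scale scale f"
  shows "f (poly_of_map scale p f v) = poly_of_map scale p f (f v)"
proof -
  interpret f: Vector_Spaces.linear scale scale f by fact
  show ?thesis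
    by (induction p) (simp_all add: poly_of_map_pCons[OF assms] f.scale f.add f.zero)
qed

lemma poly_of_map_eigenvector:
  assumes "Vector_Spaces.linear scale scale f" and "f v = t *s v"
  shows "poly_of_map scale p f v = poly p t *s v"
proof -
  interpret f: Vector_Spaces.linear scale scale f by fact
  show ?thesis
    by (induction p)
      (simp_all add: poly_of_map_pCons[OF assms(1)] f.scale assms(2) scale_left_distrib mult.commute)
qed

text \<open>On \<open>S\<close> the functional \<open>\<phi>\<close> is an eigenvector of the
  transpose of \<open>f\<close>. Hence \<open>t\<close> is a root of \<open>p\<close> as soon as
  \<open>\<phi>\<close> kills \<open>p(f) u\<close> but not \<open>u\<close>.\<close>

lemma functional_poly_of_map:
  assumes "Vector_Spaces.linear scale scale f"
    and "subspace S" and inv: "\<And>u. u \<in> S \<Longrightarrow> f u \<in> S"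
    and "\<And>u v. \<phi> (u + v) = \<phi> u + \<phi> v" and "\<And>a u. \<phi> (a *s u) = a * \<phi> u"
    and fixed: "\<And>u. u \<in> S \<Longrightarrow> \<phi> (f u) = t * \<phi> u"
    and "u \<in> S"
  shows "\<phi> (poly_of_map scale p f u) = poly p t * \<phi> u"
proof (induction p)
  case 0
  have "\<phi> (0 *s 0) = 0 * \<phi> 0" by (rule assms)
  then show ?case by simp
next
  case (pCons a p)
  have "poly_of_map scale p f u \<in> S"
    using assms by (intro poly_of_map_in_subspace) auto
  then show ?case
    using pCons assms by (simp add: poly_of_map_pCons algebra_simps)
qed

text \<open>The polynomial \<open>q\<close> is the minimal polynomial of the map induced by \<open>f\<close> on \<open>S / (S \<inter> B)\<close>.\<close>

lemma relative_minimal_polynomial: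
  assumes f: "Vector_Spaces.linear scale scale f"
    and S: "subspace S" "\<And>u. u \<in> S \<Longrightarrow> f u \<in> S"
    and B: "subspace B"
    and p: "p \<noteq> 0" "\<And>u. u \<in> S \<Longrightarrow> poly_of_map scale p f u \<in> B"
    and nsub: "\<not> S \<subseteq> B"
  obtains q where "degree q > 0" and "\<And>u. u \<in> S \<Longrightarrow> poly_of_map scale q f u \<in> B"
    and "\<And>t. poly q t = 0 \<Longrightarrow> \<exists>w \<in> S - B. f w - t *s w \<in> B"
proof -
  define Q where "Q q \<longleftrightarrow> q \<noteq> 0 \<and> (\<forall>u\<in>S. poly_of_map scale q f u \<in> B)" for q
  have "Q p" using p by (simp add: Q_def)
  then obtain q where q: "Q q" and min: "\<And>r. Q r \<Longrightarrow> degree q \<le> degree r"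
    using ex_has_least_nat[of Q p degree] by blast
  have qB: "poly_of_map scale q f u \<in> B" if "u \<in> S" for u
    using q that by (simp add: Q_def)
  have "degree q > 0"
  proof (rule ccontr)
    assume "\<not> degree q > 0"
    then obtain a where a: "q = [:a:]" by (auto elim: degree_eq_zeroE)
    with q have "a \<noteq> 0" by (auto simp: Q_def)
    have "u \<in> B" if "u \<in> S" for u
    proof -
      interpret f: Vector_Spaces.linear scale scale f by fact
      have "a *s u \<in> B"
        using qB[OF that] by (simp add: a poly_of_map_pCons[OF f] f.zero)
      then show ?thesis using \<open>a \<noteq> 0\<close> by (rule subspace_scale_cancel[OF B])
    qed
    with nsub show False by blast
  qed
  moreover have "\<exists>w \<in> S - B. f w - t *s w \<in> B" if root: "poly q t = 0" for t
  proof -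
    \<comment> \<open>The cofactor \<open>r\<close> has smaller degree, so by minimality
      \<open>r(f)\<close> moves some \<open>u\<close> of \<open>S\<close> outside \<open>B\<close>.
      That image is the eigenvector sought: the remaining linear factor brings it back into
      \<open>B\<close>.\<close>
    obtain r where r: "q = [:- t, 1:] * r" using root unfolding poly_eq_0_iff_dvd by (rule dvdE)
    have "r \<noteq> 0" using q r by (auto simp: Q_def)
    then have "degree q = Suc (degree r)" by (simp add: r degree_mult_eq del: mult_pCons_left)
    with min[of r] have "\<not> Q r" by auto
    with \<open>r \<noteq> 0\<close> obtain u where u: "u \<in> S" "poly_of_map scale r f u \<notin> B" by (auto simp: Q_def)
    have "poly_of_map scale r f u \<in> S" using f S u by (intro poly_of_map_in_subspace) auto
    moreover have "f (poly_of_map scale r f u) - t *s poly_of_map scale r f u \<in> B"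
      using qB[OF u(1)] unfolding r poly_of_map_root_mult[OF f] .
    ultimately show ?thesis using u by blast
  qed
  ultimately show thesis using qB that by blast
qed

section \<open>Ordered bases and coordinates\<close>

text \<open>Coefficients are indexed by positions, not by vectors, so that a repeated vector also
  counts as a linear relation.\<close>

lemma distinct_independentI:
  assumes lin: "\<And>a i. (\<Sum>i<length bs. a i *s (bs ! i)) = 0 \<Longrightarrow> i < length bs \<Longrightarrow> a i = 0"
  shows "distinct bs" and "independent (set bs)"
proof -
  show dist: "distinct bs"
  proof (rule ccontr)
    assume "\<not> distinct bs"
    then obtain i j where ij: "i < length bs" "j < length bs" "i \<noteq> j" "bs ! i = bs ! j"
      by (auto simp: distinct_conv_nth)
    \<comment> \<open>The relation that a repetition produces: coefficient 1 at \<open>i\<close> and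
      -1 at \<open>j\<close>.\<close>
    define a :: "nat \<Rightarrow> 'a" where "a l = (if l = i then 1 else 0) - (if l = j then 1 else 0)" for l
    have "(\<Sum>l<length bs. a l *s (bs ! l)) = bs ! i - bs ! j"
      using ij by (simp add: a_def scale_left_diff_distrib sum_subtractf if_distrib[of "\<lambda>s. s *s _"]
          cong: if_cong)
    then have "a i = 0" using lin[of a] ij by simp
    then show False using ij by (simp add: a_def)
  qed
  show "independent (set bs)"
  proof
    assume "dependent (set bs)"
    then obtain u w where u: "w \<in> set bs" "u w \<noteq> 0" "(\<Sum>v\<in>set bs. u v *s v) = 0"
      by (auto simp: dependent_finite)
    have "(\<Sum>i<length bs. u (bs ! i) *s (bs ! i)) = (\<Sum>v\<in>set bs. u v *s v)"
      using sum.reindex_bij_betw[OF bij_betw_nth[OF dist refl refl], of "\<lambda>v. u v *s v"] by simp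
    with u lin[of "\<lambda>i. u (bs ! i)"] show False by (auto simp: in_set_conv_nth)
  qed
qed

lemma representation_nth:
  assumes "ordered_basis scale bs" and "j < length bs"
  shows "representation (set bs) (\<Sum>i<length bs. a i *s (bs ! i)) (bs ! j) = a j"
proof -
  have ind: "independent (set bs)" and dist: "distinct bs" and span: "span (set bs) = UNIV"
    using assms by (auto simp: ordered_basis_def)
  have "representation (set bs) (\<Sum>i<length bs. a i *s (bs ! i)) (bs ! j)
    = (\<Sum>i<length bs. a i * representation (set bs) (bs ! i) (bs ! j))"
    by (simp add: representation_sum[OF ind] representation_scale[OF ind] span)
  also have "\<dots> = (\<Sum>i<length bs. if i = j then a i else 0)"
    using assms dist
    by (intro sum.cong) (auto simp: representation_basis[OF ind] nth_eq_iff_index_eq)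
  finally show ?thesis using assms by simp
qed

lemma matrix_of_map_eq_mat:
  assumes "ordered_basis scale bs"
    and "\<And>j. j < length bs \<Longrightarrow> f (bs ! j) = (\<Sum>i<length bs. A (i, j) *s (bs ! i))"
  shows "matrix_of_map scale bs f = mat (length bs) (length bs) A"
  using assms by (auto simp: matrix_of_map_def representation_nth)

text \<open>Splits a linear combination along the blocks of a basis; applied twice for the blocks
  \<open>x\<close>, \<open>y\<close>, \<open>z\<close>.\<close>

lemma sum_append_nth:
  "(\<Sum>i<length (xs @ ys). a i *s ((xs @ ys) ! i))
    = (\<Sum>i<length xs. a i *s (xs ! i)) + (\<Sum>i<length ys. a (length xs + i) *s (ys ! i))"
proof -
  have "{..<length xs + length ys} = {..<length xs} \<union> (\<lambda>i. length xs + i) ` {..<length ys}"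
    by (auto simp: lessThan_atLeast0)
  then show ?thesis
    by (simp, subst sum.union_disjoint) (auto simp: sum.reindex nth_append)
qed

end

section \<open>Conformal alternating forms\<close>

text \<open>What a Heisenberg Hom-Lie algebra provides: \<open>\<omega>\<close> is the coefficient
  of the bracket along a generator \<open>z\<close> of the derived line. The radical condition
  encodes that this line is the center, and conformality encodes multiplicativity.\<close>

locale conformal_form = vector_space scale + twist: Vector_Spaces.linear scale scale \<alpha>
  for scale :: "complex \<Rightarrow> 'v::ab_group_add \<Rightarrow> 'v" (infixr \<open>*s\<close> 75) and \<alpha> :: "'v \<Rightarrow> 'v" +
  fixes \<omega> :: "'v \<Rightarrow> 'v \<Rightarrow> complex" and z :: 'v and c :: complex
  assumes form_add_left: "\<omega> (u + v) w = \<omega> u w + \<omega> v w"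
    and form_scale_left: "\<omega> (a *s u) w = a * \<omega> u w"
    and form_skew: "\<omega> u v = - \<omega> v u"
    and form_radical: "(\<forall>v. \<omega> u v = 0) \<longleftrightarrow> u \<in> span {z}"
    and form_conformal: "\<omega> (\<alpha> u) (\<alpha> v) = c * \<omega> u v"
    and z_nonzero: "z \<noteq> 0"
    and twist_z: "\<alpha> z = c *s z"
    and c_nonzero: "c \<noteq> 0"
begin

lemma form_add_right: "\<omega> w (u + v) = \<omega> w u + \<omega> w v"
  by (metis form_add_left form_skew minus_add_distrib)

lemma form_scale_right: "\<omega> w (a *s u) = a * \<omega> w u"
  by (metis form_scale_left form_skew mult_minus_right)

lemma form_self [simp]: "\<omega> u u = 0"
  using form_skew[of u u] by simp

lemma form_0_left [simp]: "\<omega> 0 w = 0"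
  using form_scale_left[of 0 0 w] by simp

lemma form_0_right [simp]: "\<omega> w 0 = 0"
  using form_scale_right[of w 0 0] by simp

lemma form_diff_left: "\<omega> (u - v) w = \<omega> u w - \<omega> v w"
  using form_add_left[of "u - v" v w] by simp

lemma form_diff_right: "\<omega> w (u - v) = \<omega> w u - \<omega> w v"
  using form_add_right[of w "u - v" v] by simp

lemma form_sum_left: "\<omega> (\<Sum>i\<in>A. f i) w = (\<Sum>i\<in>A. \<omega> (f i) w)"
  by (induction A rule: infinite_finite_induct) (simp_all add: form_add_left)

lemma form_sum_right: "\<omega> w (\<Sum>i\<in>A. f i) = (\<Sum>i\<in>A. \<omega> w (f i))"
  by (induction A rule: infinite_finite_induct) (simp_all add: form_add_right)

lemmas form_simps = form_add_left form_add_right form_scale_left form_scale_right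
  form_diff_left form_diff_right form_sum_left form_sum_right

lemma form_z_left [simp]: "\<omega> z v = 0"
  using form_radical[of z] by (simp add: span_base)

lemma form_z_right [simp]: "\<omega> v z = 0"
  using form_skew[of v z] by simp

lemma form_span_left:
  assumes "u \<in> span A" and "\<And>a. a \<in> A \<Longrightarrow> \<omega> a v = 0"
  shows "\<omega> u v = 0"
proof -
  have "subspace {u. \<omega> u v = 0}" by (auto simp: subspace_def form_simps)
  then have "span A \<subseteq> {u. \<omega> u v = 0}" using assms by (intro span_minimal) auto
  then show ?thesis using assms by auto
qed

text \<open>By conformality the kernel of \<open>\<alpha>\<close> lies in the radical, the line of
  \<open>z\<close>, where \<open>\<alpha>\<close> is multiplication by
  \<open>c \<noteq> 0\<close>.\<close>

lemma twist_inj: "\<alpha> u = \<alpha> v \<longleftrightarrow> u = v"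
proof
  assume "\<alpha> u = \<alpha> v"
  then have 0: "\<alpha> (u - v) = 0" by (simp add: twist.diff)
  have "\<omega> (u - v) w = 0" for w
    using form_conformal[of "u - v" w] c_nonzero by (simp add: 0)
  then obtain t where t: "u - v = t *s z"
    using form_radical[of "u - v"] by (auto simp: span_singleton)
  with 0 have "t * c = 0" using z_nonzero by (simp add: twist.scale twist_z)
  with t c_nonzero show "u = v" by simp
qed simp

text \<open>The second condition says that \<open>\<alpha>\<close> restricts to an automorphism of the span of the \<open>x i\<close>;
  stating it as an equality of spans makes the orthogonal complement invariant as well.\<close>

definition hyperbolic :: "nat \<Rightarrow> (nat \<Rightarrow> 'v) \<Rightarrow> (nat \<Rightarrow> 'v) \<Rightarrow> bool" where
  "hyperbolic n x y \<longleftrightarrow>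
     (\<forall>i<n. \<forall>j<n. \<omega> (x i) (y j) = (if i = j then 1 else 0) \<and> \<omega> (x i) (x j) = 0 \<and> \<omega> (y i) (y j) = 0) \<and>
     span (\<alpha> ` x ` {..<n}) = span (x ` {..<n})"

text \<open>For a hyperbolic system, the projection onto the orthogonal complement of all
  \<open>x i\<close> and \<open>y i\<close>: the components of \<open>u\<close> along them are
  subtracted.\<close>

definition perp_proj :: "nat \<Rightarrow> (nat \<Rightarrow> 'v) \<Rightarrow> (nat \<Rightarrow> 'v) \<Rightarrow> 'v \<Rightarrow> 'v" where
  "perp_proj n x y u = u - (\<Sum>i<n. \<omega> u (y i) *s x i) - (\<Sum>i<n. \<omega> (x i) u *s y i)"

section \<open>Orthogonality with respect to a hyperbolic system\<close>

context
  fixes n :: nat and x y :: "nat \<Rightarrow> 'v"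
  assumes hyp: "hyperbolic n x y"
begin

lemma form_x_y: "i < n \<Longrightarrow> j < n \<Longrightarrow> \<omega> (x i) (y j) = (if i = j then 1 else 0)"
  and form_x_x: "i < n \<Longrightarrow> j < n \<Longrightarrow> \<omega> (x i) (x j) = 0"
  and form_y_y: "i < n \<Longrightarrow> j < n \<Longrightarrow> \<omega> (y i) (y j) = 0"
  and span_twist_x: "span (\<alpha> ` x ` {..<n}) = span (x ` {..<n})"
  using hyp by (auto simp: hyperbolic_def)

lemma form_x_perp_proj: "j < n \<Longrightarrow> \<omega> (x j) (perp_proj n x y u) = 0"
  by (simp add: perp_proj_def form_simps form_x_x form_x_y if_distrib[of "\<lambda>t. _ * t"] cong: if_cong)

lemma form_perp_proj_y: "j < n \<Longrightarrow> \<omega> (perp_proj n x y u) (y j) = 0"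
  by (simp add: perp_proj_def form_simps form_y_y form_x_y if_distrib[of "\<lambda>t. _ * t"] cong: if_cong)

text \<open>Pairing with \<open>y i\<close> reads off the coordinate at \<open>x i\<close>; in
  particular a vector of the span that is orthogonal to every \<open>y i\<close> is 0.\<close>

lemma span_x_eq:
  assumes "u \<in> span (x ` {..<n})"
  shows "u = (\<Sum>i<n. \<omega> u (y i) *s x i)"
proof -
  have "subspace {u. u = (\<Sum>i<n. \<omega> u (y i) *s x i)}"
  proof (rule subspaceI)
    fix a u assume u: "u \<in> {u. u = (\<Sum>i<n. \<omega> u (y i) *s x i)}"
    have "(\<Sum>i<n. \<omega> (a *s u) (y i) *s x i) = a *s (\<Sum>i<n. \<omega> u (y i) *s x i)"
      by (simp add: form_simps scale_sum_right)
    then show "a *s u \<in> {u. u = (\<Sum>i<n. \<omega> u (y i) *s x i)}" using u by simp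
  qed (auto simp: form_simps scale_left_distrib sum.distrib)
  moreover have "x j = (\<Sum>i<n. \<omega> (x j) (y i) *s x i)" if "j < n" for j
    using that by (simp add: form_x_y if_distrib[of "\<lambda>t. t *s _"] cong: if_cong)
  ultimately have "span (x ` {..<n}) \<subseteq> {u. u = (\<Sum>i<n. \<omega> u (y i) *s x i)}"
    by (intro span_minimal) auto
  then show ?thesis using assms by auto
qed

lemma z_notin_span_x: "z \<notin> span (x ` {..<n})"
  using span_x_eq[of z] z_nonzero by auto

lemma twist_span_x: "\<alpha> ` span (x ` {..<n}) = span (x ` {..<n})"
  using span_twist_x twist.span_image[of "x ` {..<n}"] by simp

lemma form_span_x:
  assumes "l \<in> span (x ` {..<n})" and "\<And>i. i < n \<Longrightarrow> \<omega> (x i) u = 0"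
  shows "\<omega> l u = 0"
  using assms by (auto intro: form_span_left)

lemma form_span_z_x:
  assumes "b \<in> span (insert z (x ` {..<n}))" and "\<And>i. i < n \<Longrightarrow> \<omega> (x i) u = 0"
  shows "\<omega> b u = 0"
  using assms by (auto intro: form_span_left)

text \<open>Since \<open>\<alpha>\<close> maps the span of the \<open>x i\<close> onto itself,
  \<open>x i = \<alpha> l\<close> with \<open>l\<close> in that span, and
  \<open>\<omega> (\<alpha> l) (\<alpha> u) = c * \<omega> l u = 0\<close>.\<close>

lemma twist_perp:
  assumes "\<And>i. i < n \<Longrightarrow> \<omega> (x i) u = 0" and "i < n"
  shows "\<omega> (x i) (\<alpha> u) = 0"
proof -
  have "x i \<in> \<alpha> ` span (x ` {..<n})"
    using assms(2) by (simp add: twist_span_x span_base)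
  then obtain l where "l \<in> span (x ` {..<n})" "x i = \<alpha> l" by auto
  then show ?thesis using form_span_x[of l u] assms(1) by (simp add: form_conformal)
qed

lemma perp_proj_diff_span:
  assumes "\<And>i. i < n \<Longrightarrow> \<omega> (x i) v = 0"
  shows "v - perp_proj n x y v \<in> span (x ` {..<n})"
proof -
  have "v - perp_proj n x y v = (\<Sum>i<n. \<omega> v (y i) *s x i)"
    using assms by (simp add: perp_proj_def)
  moreover have "\<dots> \<in> span (x ` {..<n})"
    by (intro span_sum span_scale span_base) auto
  ultimately show ?thesis by simp
qed

section \<open>Extending a hyperbolic system, and the complement of a maximal one\<close>

lemma perp_nondegenerate:
  assumes perp: "\<And>i. i < n \<Longrightarrow> \<omega> (x i) v = 0" and nB: "v \<notin> span (insert z (x ` {..<n}))"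
  obtains u where "\<forall>i<n. \<omega> (x i) u = 0 \<and> \<omega> u (y i) = 0" and "\<omega> v u = 1"
    and "\<omega> (perp_proj n x y v) u = 1"
proof -
  let ?v = "perp_proj n x y v"
  have l: "v - ?v \<in> span (x ` {..<n})" using perp by (rule perp_proj_diff_span)
  have "?v \<notin> span {z}"
  proof
    assume "?v \<in> span {z}"
    then have "?v \<in> span (insert z (x ` {..<n}))" by (rule set_mp[OF span_mono, rotated]) auto
    moreover have "v - ?v \<in> span (insert z (x ` {..<n}))"
      using l by (rule set_mp[OF span_mono, rotated]) auto
    ultimately show False using nB span_add[of "v - ?v" _ ?v] by auto
  qed
  then obtain w where w: "\<omega> ?v w \<noteq> 0" using form_radical by blast
  define u where "u = inverse (\<omega> ?v w) *s perp_proj n x y w"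
  have "\<omega> ?v (x i) = 0" if "i < n" for i
    using form_x_perp_proj[OF that, of v] form_skew[of ?v "x i"] by simp
  \<comment> \<open>Replacing \<open>w\<close> by its projection keeps the pairing, because
    \<open>?v\<close> is orthogonal to all \<open>x i\<close> and \<open>y i\<close>.\<close>
  then have "\<omega> ?v (perp_proj n x y w) = \<omega> ?v w"
    by (simp add: perp_proj_def[of n x y w] form_simps form_perp_proj_y)
  then have 1: "\<omega> ?v u = 1" using w by (simp add: u_def form_simps)
  have ux: "\<omega> (x i) u = 0" if "i < n" for i
    using that by (simp add: u_def form_simps form_x_perp_proj)
  have uy: "\<omega> u (y i) = 0" if "i < n" for i
    using that by (simp add: u_def form_simps form_perp_proj_y)
  have "\<omega> (v - ?v) u = 0" using l ux by (rule form_span_x)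
  then have "\<omega> v u = 1" using 1 by (simp add: form_simps)
  with 1 ux uy that show thesis by blast
qed

text \<open>The new pair is the projection \<open>v'\<close> of \<open>v\<close> and a dual vector
  \<open>u\<close>. The difference \<open>v - v'\<close> lies in the invariant span of the
  \<open>x i\<close>, so \<open>v'\<close> is still an eigenvector modulo that span.\<close>

lemma extend_hyperbolic:
  assumes perp: "\<And>i. i < n \<Longrightarrow> \<omega> (x i) v = 0" and nB: "v \<notin> span (insert z (x ` {..<n}))"
    and eig: "\<alpha> v - t *s v \<in> span (x ` {..<n})"
  shows "\<exists>x' y'. hyperbolic (Suc n) x' y'"
proof -
  let ?A = "x ` {..<n}"
  define v' where "v' = perp_proj n x y v"
  obtain u where u: "\<forall>i<n. \<omega> (x i) u = 0 \<and> \<omega> u (y i) = 0" "\<omega> v' u = 1"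
    using perp_nondegenerate[OF perp nB] unfolding v'_def by blast
  have v': "\<omega> (x i) v' = 0" "\<omega> v' (y i) = 0" if "i < n" for i
    using that by (simp_all add: v'_def form_x_perp_proj form_perp_proj_y)
  define l where "l = v - v'"
  have l: "l \<in> span ?A" unfolding l_def v'_def using perp by (rule perp_proj_diff_span)
  then have "\<alpha> l \<in> span ?A" using twist_span_x by auto
  then have "(\<alpha> v - t *s v) - (\<alpha> l - t *s l) \<in> span ?A"
    using eig l by (intro span_diff[of "\<alpha> v - t *s v"] span_diff[of "\<alpha> l"] span_scale)
  then have eig': "\<alpha> v' - t *s v' \<in> span ?A"
    by (simp add: l_def twist.diff scale_right_diff_distrib)
  have nv': "v' \<notin> span ?A"
  proof
    assume "v' \<in> span ?A"
    then have "v \<in> span ?A" using l span_add[of l _ v'] by (auto simp: l_def)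
    then show False using nB span_mono[of ?A "insert z ?A"] by auto
  qed
  \<comment> \<open>If \<open>t = 0\<close>, then \<open>\<alpha> v'\<close> is in the image of the
    old span, and injectivity puts \<open>v'\<close> into it. A nonzero \<open>t\<close> is what
    lets \<open>v'\<close> be recovered from \<open>\<alpha> v'\<close> below.\<close>
  have "t \<noteq> 0"
  proof
    assume "t = 0"
    with eig' have "\<alpha> v' \<in> \<alpha> ` span ?A" by (simp add: twist_span_x)
    with nv' show False by (auto simp: twist_inj)
  qed
  define x' where "x' = x(n := v')"
  define y' where "y' = y(n := u)"
  have im: "x' ` {..<Suc n} = insert v' ?A" by (auto simp: x'_def lessThan_Suc)
  have "span (\<alpha> ` insert v' ?A) \<subseteq> span (insert v' ?A)"
  proof (rule span_minimal[OF _ subspace_span])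
    have sub: "span ?A \<subseteq> span (insert v' ?A)" by (rule span_mono) auto
    have "(\<alpha> v' - t *s v') + t *s v' \<in> span (insert v' ?A)"
      using eig' sub by (intro span_add[of "\<alpha> v' - t *s v'"] span_scale[OF span_base]) auto
    moreover have "\<alpha> ` ?A \<subseteq> span ?A" using span_superset[of "\<alpha> ` ?A"] unfolding span_twist_x .
    ultimately show "\<alpha> ` insert v' ?A \<subseteq> span (insert v' ?A)" using sub by auto
  qed
  moreover have "span (insert v' ?A) \<subseteq> span (\<alpha> ` insert v' ?A)"
  proof (rule span_minimal[OF _ subspace_span])
    have "span (\<alpha> ` ?A) \<subseteq> span (\<alpha> ` insert v' ?A)" by (rule span_mono) auto
    then have sub: "span ?A \<subseteq> span (\<alpha> ` insert v' ?A)" by (simp add: span_twist_x)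
    have "\<alpha> v' \<in> span (\<alpha> ` insert v' ?A)" by (rule span_base) simp
    then have "\<alpha> v' - (\<alpha> v' - t *s v') \<in> span (\<alpha> ` insert v' ?A)"
      by (rule span_diff) (rule subsetD[OF sub eig'])
    then have "t *s v' \<in> span (\<alpha> ` insert v' ?A)" by simp
    then have "v' \<in> span (\<alpha> ` insert v' ?A)"
      using \<open>t \<noteq> 0\<close> by (rule subspace_scale_cancel[OF subspace_span])
    then show "insert v' ?A \<subseteq> span (\<alpha> ` insert v' ?A)"
      using sub span_superset[of ?A] by auto
  qed
  ultimately have "span (\<alpha> ` x' ` {..<Suc n}) = span (x' ` {..<Suc n})" by (simp add: im)
  moreover have "\<omega> (x' i) (y' j) = (if i = j then 1 else 0) \<and> \<omega> (x' i) (x' j) = 0 \<and> \<omega> (y' i) (y' j) = 0"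
    if "i < Suc n" "j < Suc n" for i j
    using that u v' form_skew[of v' "x j"] form_skew[of "y i" u]
    by (auto simp: x'_def y'_def less_Suc_eq form_x_x form_x_y form_y_y)
  ultimately show ?thesis unfolding hyperbolic_def by blast
qed

lemma maximal_hyperbolic_perp:
  assumes max: "\<nexists>x' y'. hyperbolic (Suc n) x' y'"
    and p: "p \<noteq> 0" "\<And>v. poly_of_map scale p \<alpha> v = 0"
    and c: "c \<noteq> 1 \<or> Polynomial.order c p = 1"
    and perp: "\<And>i. i < n \<Longrightarrow> \<omega> (x i) u = 0"
  shows "u \<in> span (insert z (x ` {..<n}))"
proof (rule ccontr)
  assume nu: "u \<notin> span (insert z (x ` {..<n}))"
  define S where "S = {u. \<forall>i<n. \<omega> (x i) u = 0}"
  define L where "L = span (x ` {..<n})"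
  define B where "B = span (insert z (x ` {..<n}))"
  have S: "subspace S" "\<And>u. u \<in> S \<Longrightarrow> \<alpha> u \<in> S"
    by (auto simp: S_def subspace_def form_simps twist_perp)
  have B: "subspace B" and L: "subspace L" by (simp_all add: B_def L_def)
  have "\<not> S \<subseteq> B" using nu perp by (auto simp: S_def B_def)
  have B_iff: "b \<in> B \<longleftrightarrow> (\<exists>k. b - k *s z \<in> L)" for b
    by (simp add: B_def L_def span_breakdown_eq)
  have zB: "z \<in> B" by (simp add: B_def span_base)
  \<comment> \<open>Such an eigenvector would extend the system, against maximality.\<close>
  have no_eig: "\<alpha> v - t *s v \<notin> L" if "v \<in> S - B" for v t
    using extend_hyperbolic[of v t] max that by (auto simp: S_def B_def L_def)
  have SB: "\<omega> b u = 0" if "b \<in> B" "u \<in> S" for b u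
    using form_span_z_x[of b u] that by (auto simp: B_def S_def)
  have eig_c: "t = c" if w: "w \<in> S - B" "\<alpha> w - t *s w \<in> B" for w t
  proof (rule ccontr)
    assume "t \<noteq> c"
    obtain k where k: "\<alpha> w - t *s w - k *s z \<in> L" using w B_iff by blast
    \<comment> \<open>Chosen so that \<open>a *s z\<close> contributes
      \<open>a * (c - t) = - k\<close> times \<open>z\<close>, which cancels the error term
      \<open>k *s z\<close>.\<close>
    define a where "a = k / (t - c)"
    define w' where "w' = w + a *s z"
    have "\<alpha> w' - t *s w' = \<alpha> w - t *s w - (a * (t - c)) *s z"
      by (simp add: w'_def twist.add twist.scale twist_z algebra_simps scale_left_distrib
          scale_left_diff_distrib scale_right_distrib)
    then have "\<alpha> w' - t *s w' \<in> L" using k \<open>t \<noteq> c\<close> by (simp add: a_def)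
    moreover have "w' \<in> S" using w by (simp add: w'_def S_def form_simps)
    moreover have "w' \<notin> B"
      using w subspace_diff[OF B, of w' "a *s z"] subspace_scale[OF B zB]
      by (auto simp: w'_def)
    ultimately show False using no_eig by blast
  qed
  obtain q where q: "degree q > 0" "\<And>u. u \<in> S \<Longrightarrow> poly_of_map scale q \<alpha> u \<in> B"
    "\<And>t. poly q t = 0 \<Longrightarrow> \<exists>w \<in> S - B. \<alpha> w - t *s w \<in> B"
    using relative_minimal_polynomial[OF twist.linear_axioms S B p(1) _ \<open>\<not> S \<subseteq> B\<close>]
      p(2) subspace_0[OF B] by metis
  have "\<not> constant (poly q)" using q(1) by (simp add: constant_degree)
  then obtain t where "poly q t = 0" using fundamental_theorem_of_algebra by blast
  with q(3) eig_c obtain w where w: "w \<in> S - B" "\<alpha> w - c *s w \<in> B" by blast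
  show False
  proof (cases "c = 1")
    case False
    \<comment> \<open>The vector \<open>\<alpha> w - c *s w\<close> of \<open>B\<close> is
      orthogonal to \<open>S\<close>. Pairing it with \<open>\<alpha> u\<close> gives
      \<open>c * \<omega> w u = c * \<omega> w (\<alpha> u)\<close>.\<close>
    have fixed: "\<omega> w (\<alpha> u) = 1 * \<omega> w u" if "u \<in> S" for u
    proof -
      have "\<omega> (\<alpha> w - c *s w) (\<alpha> u) = 0" using SB w S that by blast
      then show ?thesis using c_nonzero by (simp add: form_simps form_conformal)
    qed
    have "\<And>i. i < n \<Longrightarrow> \<omega> (x i) w = 0" and "w \<notin> span (insert z (x ` {..<n}))"
      using w by (simp_all add: S_def B_def)
    then obtain u where u: "\<forall>i<n. \<omega> (x i) u = 0 \<and> \<omega> u (y i) = 0" and wu: "\<omega> w u = 1"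
      by (rule perp_nondegenerate)
    have "u \<in> S" using u by (simp add: S_def)
    \<comment> \<open>Pairing with \<open>w\<close> has eigenvalue 1 under the transpose and
      vanishes on \<open>B\<close>, which contains \<open>q(\<alpha>) u\<close>. So 1 is a root of
      \<open>q\<close>, and \<open>eig_c\<close> would give \<open>c = 1\<close>.\<close>
    then have "\<omega> w (poly_of_map scale q \<alpha> u) = poly q 1 * \<omega> w u"
      using S fixed by (intro functional_poly_of_map[OF twist.linear_axioms, of S])
        (auto simp: form_simps)
    moreover have "\<omega> w (poly_of_map scale q \<alpha> u) = 0"
      using SB[OF q(2)[OF \<open>u \<in> S\<close>], of w] w form_skew[of w] by simp
    ultimately have "poly q 1 = 0" using wu by simp
    then show False using q(3) eig_c False by metis
  next
    case True
    then have "Polynomial.order c p = 1" using c by simp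
    then obtain r where r: "p = [:- c, 1:] * r" "\<not> [:- c, 1:] dvd r"
      using order_decomp[OF p(1), of c] by auto
    obtain k where k: "\<alpha> w - c *s w - k *s z \<in> L" using w B_iff by blast
    then have "k \<noteq> 0" using no_eig[OF w(1)] by auto
    \<comment> \<open>Write \<open>\<alpha> w - c *s w = l + k *s z\<close> with \<open>l\<close> in
      \<open>L\<close> and apply \<open>r(\<alpha>)\<close>. The left side becomes
      \<open>p(\<alpha>) w = 0\<close>, so \<open>k * poly r c\<close> times \<open>z\<close> lies
      in the invariant \<open>L\<close>; this factor is nonzero because \<open>c\<close> is a simple
      root of \<open>p\<close>.\<close>
    have "0 = \<alpha> (poly_of_map scale r \<alpha> w) - c *s poly_of_map scale r \<alpha> w"
      using p(2)[of w] unfolding r(1) poly_of_map_root_mult[OF twist.linear_axioms] by simp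
    also have "\<dots> = poly_of_map scale r \<alpha> (\<alpha> w + (- c) *s w)"
      by (simp add: poly_of_map_vec_add[OF twist.linear_axioms]
          poly_of_map_vec_scale[OF twist.linear_axioms] poly_of_map_commute[OF twist.linear_axioms]
          del: scale_minus_left) simp
    also have "\<alpha> w + (- c) *s w = (\<alpha> w - c *s w - k *s z) + k *s z" by simp
    also have "poly_of_map scale r \<alpha> \<dots>
        = poly_of_map scale r \<alpha> (\<alpha> w - c *s w - k *s z) + (k * poly r c) *s z"
      by (simp only: poly_of_map_vec_add[OF twist.linear_axioms]
          poly_of_map_vec_scale[OF twist.linear_axioms]
          poly_of_map_eigenvector[OF twist.linear_axioms twist_z] scale_scale)
    finally have *: "(k * poly r c) *s z = - poly_of_map scale r \<alpha> (\<alpha> w - c *s w - k *s z)"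
      by (simp add: eq_neg_iff_add_eq_0 add.commute)
    have "\<alpha> u \<in> L" if "u \<in> L" for u using that twist_span_x by (auto simp: L_def)
    with k L have "poly_of_map scale r \<alpha> (\<alpha> w - c *s w - k *s z) \<in> L"
      by (intro poly_of_map_in_subspace[OF twist.linear_axioms]) auto
    with * L have "(k * poly r c) *s z \<in> L" by (simp add: subspace_neg)
    moreover have "k * poly r c \<noteq> 0" using \<open>k \<noteq> 0\<close> r(2) by (simp add: poly_eq_0_iff_dvd)
    ultimately have "z \<in> L" by (rule subspace_scale_cancel[OF L])
    then show False using z_notin_span_x by (simp add: L_def)
  qed
qed

section \<open>Coordinates, basis and block matrix of a hyperbolic system\<close>

lemma perp_expansion:
  assumes "\<And>u. (\<And>i. i < n \<Longrightarrow> \<omega> (x i) u = 0) \<Longrightarrow> u \<in> span (insert z (x ` {..<n}))"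
  shows "\<exists>a. u = (\<Sum>i<n. \<omega> u (y i) *s x i) + (\<Sum>i<n. \<omega> (x i) u *s y i) + a *s z"
proof -
  have "perp_proj n x y u \<in> span (insert z (x ` {..<n}))"
    by (rule assms) (rule form_x_perp_proj)
  then obtain a where a: "perp_proj n x y u - a *s z \<in> span (x ` {..<n})"
    by (auto simp: span_breakdown_eq)
  \<comment> \<open>The vector lies in the span of the \<open>x i\<close>, and all its coordinates,
    the pairings with the \<open>y i\<close>, are 0.\<close>
  have "perp_proj n x y u - a *s z = 0"
    using span_x_eq[OF a] by (simp add: form_simps form_perp_proj_y)
  then show ?thesis by (auto simp: perp_proj_def algebra_simps)
qed

text \<open>The \<open>x i\<close> are independent, as pairing with the \<open>y i\<close> shows.
  The bound guarantees a hyperbolic system of maximal length.\<close>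

lemma hyperbolic_le_dim:
  assumes "dim UNIV > 0"
  shows "n \<le> dim UNIV"
proof -
  have "a i = 0" if 0: "(\<Sum>i<length (map x [0..<n]). a i *s (map x [0..<n] ! i)) = 0"
    and i: "i < length (map x [0..<n])" for a i
  proof -
    have "\<omega> (\<Sum>j<n. a j *s x j) (y i) = a i"
      using i by (simp add: form_simps form_x_y if_distrib[of "\<lambda>t. _ * t"] cong: if_cong)
    then show ?thesis using 0 by simp
  qed
  note lin = this
  have dist: "distinct (map x [0..<n])" by (rule distinct_independentI) (rule lin)
  have ind: "independent (set (map x [0..<n]))" by (rule distinct_independentI) (rule lin)
  obtain D where D: "UNIV \<subseteq> span D" "card D = dim UNIV" by (rule basis_exists[of UNIV])
  \<comment> \<open>\<open>card\<close> is 0 on infinite sets, so positive dimension means finite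
    dimension.\<close>
  with assms have "finite D" by (intro card_ge_0_finite) simp
  moreover have "set (map x [0..<n]) \<subseteq> span D" using D by blast
  ultimately have "card (set (map x [0..<n])) \<le> card D"
    using independent_span_bound[OF _ ind] by blast
  also have "card (set (map x [0..<n])) = n" using distinct_card[OF dist] by simp
  finally show ?thesis using D by simp
qed

lemma hyperbolic_ordered_basis:
  assumes "\<And>u. (\<And>i. i < n \<Longrightarrow> \<omega> (x i) u = 0) \<Longrightarrow> u \<in> span (insert z (x ` {..<n}))"
  shows "ordered_basis scale (map x [0..<n] @ map y [0..<n] @ [z])" (is "ordered_basis _ ?bs")
proof -
  have "a i = 0" if 0: "(\<Sum>i<length ?bs. a i *s (?bs ! i)) = 0" and i: "i < length ?bs" for a i
  proof -
    \<comment> \<open>Positions \<open>0..<n\<close> hold the \<open>x j\<close>, the next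
      \<open>n\<close> the \<open>y j\<close>, and position \<open>2 * n\<close> holds
      \<open>z\<close>. Pairing with \<open>y j\<close> isolates \<open>a j\<close>, pairing with
      \<open>x j\<close> isolates \<open>a (n + j)\<close>.\<close>
    have sum: "(\<Sum>j<n. a j *s x j) + ((\<Sum>j<n. a (n + j) *s y j) + a (2 * n) *s z) = 0"
      using 0 unfolding sum_append_nth by (simp add: mult_2)
    have x: "a j = 0" if "j < n" for j
      using arg_cong[OF sum, of "\<lambda>u. \<omega> u (y j)"] that
      by (simp add: form_simps form_x_y form_y_y if_distrib[of "\<lambda>t. _ * t"] cong: if_cong)
    have y: "a (n + j) = 0" if "j < n" for j
      using arg_cong[OF sum, of "\<lambda>u. \<omega> (x j) u"] that
      by (simp add: form_simps form_x_y form_x_x if_distrib[of "\<lambda>t. _ * t"] cong: if_cong)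
    have "a (2 * n) = 0" using sum z_nonzero by (simp add: x y)
    moreover have "i < n \<or> (\<exists>j<n. i = n + j) \<or> i = 2 * n"
      using i by simp presburger
    ultimately show ?thesis using x y by auto
  qed
  note lin = this
  have "distinct ?bs" by (rule distinct_independentI) (rule lin)
  moreover have "independent (set ?bs)" by (rule distinct_independentI) (rule lin)
  moreover have "u \<in> span (set ?bs)" for u
  proof -
    obtain a where "u = (\<Sum>i<n. \<omega> u (y i) *s x i) + (\<Sum>i<n. \<omega> (x i) u *s y i) + a *s z"
      using perp_expansion[OF assms] by blast
    moreover have "\<dots> \<in> span (set ?bs)"
      by (intro span_add span_sum span_scale span_base) auto
    ultimately show ?thesis by simp
  qed
  ultimately show ?thesis unfolding ordered_basis_def by blast
qed

text \<open>The entries of \<open>X\<close>, \<open>T\<close>, \<open>Y\<close> are pairings with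
  the system. The zeros below \<open>X\<close> express invariance of the span of the
  \<open>x i\<close>. The two matrix identities are \<open>\<omega> (\<alpha> (x i)) (\<alpha> (y
  j)) = c * \<omega> (x i) (y j)\<close> and
  \<open>\<omega> (\<alpha> (y i)) (\<alpha> (y j)) = 0\<close> in coordinates.\<close>

lemma hyperbolic_block_form:
  assumes perp: "\<And>u. (\<And>i. i < n \<Longrightarrow> \<omega> (x i) u = 0) \<Longrightarrow> u \<in> span (insert z (x ` {..<n}))"
  shows "\<exists>X T Y M. X \<in> carrier_mat n n \<and> T \<in> carrier_mat n n \<and> Y \<in> carrier_mat n n \<and>
    M \<in> carrier_mat 1 n \<and>
    matrix_of_map scale (map x [0..<n] @ map y [0..<n] @ [z]) \<alpha> = heisenberg_block_mat n X T Y M c \<and>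
    transpose_mat X * Y = c \<cdot>\<^sub>m 1\<^sub>m n \<and> transpose_mat T * Y = transpose_mat Y * T"
proof -
  let ?bs = "map x [0..<n] @ map y [0..<n] @ [z]"
  \<comment> \<open>\<open>\<gamma>\<close> is the coordinate along \<open>z\<close>, which no
    pairing detects; it supplies the row \<open>M\<close>.\<close>
  obtain \<gamma> where \<gamma>: "u = (\<Sum>i<n. \<omega> u (y i) *s x i) + (\<Sum>i<n. \<omega> (x i) u *s y i) + \<gamma> u *s z" for u
    using perp_expansion[OF perp] by metis
  have twist_x: "\<alpha> (x j) = (\<Sum>i<n. \<omega> (\<alpha> (x j)) (y i) *s x i)" if "j < n" for j
  proof (rule span_x_eq)
    show "\<alpha> (x j) \<in> span (x ` {..<n})"
      using that by (subst twist_span_x[symmetric]) (auto intro: span_base)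
  qed
  define X where "X = mat n n (\<lambda>(i, j). \<omega> (\<alpha> (x j)) (y i))"
  define T where "T = mat n n (\<lambda>(i, j). \<omega> (\<alpha> (y j)) (y i))"
  define Y where "Y = mat n n (\<lambda>(i, j). \<omega> (x i) (\<alpha> (y j)))"
  define M where "M = mat 1 n (\<lambda>(i, j). \<gamma> (\<alpha> (y j)))"
  define P where "P = heisenberg_block_mat n X T Y M c"
  have dim_P: "P \<in> carrier_mat (n + (n + 1)) (n + (n + 1))"
    by (intro carrier_matI) (simp_all add: P_def heisenberg_block_mat_def X_def T_def Y_def M_def)
  have col: "\<alpha> (?bs ! j) = (\<Sum>i<length ?bs. P $$ (i, j) *s (?bs ! i))" if j: "j < length ?bs" for j
  proof -
    have sum: "(\<Sum>i<length ?bs. P $$ (i, j) *s (?bs ! i))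
      = (\<Sum>i<n. P $$ (i, j) *s x i) + ((\<Sum>i<n. P $$ (n + i, j) *s y i) + P $$ (n + n, j) *s z)"
      unfolding sum_append_nth by simp
    have "j < n \<or> (\<exists>j'<n. j = n + j') \<or> j = n + n" using j by simp presburger
    then consider "j < n" | j' where "j' < n" "j = n + j'" | "j = n + n" by blast
    then show ?thesis
    proof cases
      case 1
      then have "P $$ (i, j) = \<omega> (\<alpha> (x j)) (y i)" "P $$ (n + i, j) = 0" "P $$ (n + n, j) = 0"
        if "i < n" for i
        using that by (simp_all add: P_def heisenberg_block_mat_def X_def T_def Y_def M_def)
      with 1 show ?thesis unfolding sum using twist_x[OF 1] by (simp add: nth_append)
    next
      case 2
      then have "P $$ (i, j) = \<omega> (\<alpha> (y j')) (y i)" "P $$ (n + i, j) = \<omega> (x i) (\<alpha> (y j'))"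
        "P $$ (n + n, j) = \<gamma> (\<alpha> (y j'))" if "i < n" for i
        using that by (simp_all add: P_def heisenberg_block_mat_def X_def T_def Y_def M_def)
      with 2 show ?thesis unfolding sum using \<gamma>[of "\<alpha> (y j')"] by (simp add: nth_append add.assoc)
    next
      case 3
      have "P $$ (n + n, j) = c" "\<And>i. i < n \<Longrightarrow> P $$ (i, j) = 0" "\<And>i. i < n \<Longrightarrow> P $$ (n + i, j) = 0"
        using 3 by (simp_all add: P_def heisenberg_block_mat_def X_def T_def Y_def M_def)
      with 3 show ?thesis unfolding sum by (simp add: nth_append twist_z)
    qed
  qed
  have "matrix_of_map scale ?bs \<alpha> = mat (length ?bs) (length ?bs) (\<lambda>ij. P $$ ij)"
    using hyperbolic_ordered_basis[OF perp] col by (rule matrix_of_map_eq_mat)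
  also have "\<dots> = P" using dim_P by (intro eq_matI) auto
  finally have mat: "matrix_of_map scale ?bs \<alpha> = P" .
  have XY: "transpose_mat X * Y = c \<cdot>\<^sub>m 1\<^sub>m n"
  proof (rule eq_matI)
    fix i j assume "i < dim_row (c \<cdot>\<^sub>m 1\<^sub>m n)" "j < dim_col (c \<cdot>\<^sub>m 1\<^sub>m n)"
    then have ij: "i < n" "j < n" by auto
    have "(transpose_mat X * Y) $$ (i, j) = (\<Sum>l<n. \<omega> (\<alpha> (x i)) (y l) * \<omega> (x l) (\<alpha> (y j)))"
      using ij by (simp add: X_def Y_def scalar_prod_def lessThan_atLeast0)
    also have "\<dots> = \<omega> (\<Sum>l<n. \<omega> (\<alpha> (x i)) (y l) *s x l) (\<alpha> (y j))"
      by (simp add: form_simps)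
    also have "\<dots> = c * (if i = j then 1 else 0)"
      using ij by (simp add: twist_x[symmetric] form_conformal form_x_y)
    finally show "(transpose_mat X * Y) $$ (i, j) = (c \<cdot>\<^sub>m 1\<^sub>m n) $$ (i, j)" using ij by simp
  qed (simp_all add: X_def Y_def)
  have TY: "transpose_mat T * Y = transpose_mat Y * T"
  proof (rule eq_matI)
    fix i j assume "i < dim_row (transpose_mat Y * T)" "j < dim_col (transpose_mat Y * T)"
    then have ij: "i < n" "j < n" by (auto simp: Y_def T_def)
    let ?u = "\<alpha> (y i)" and ?v = "\<alpha> (y j)"
    have "0 = \<omega> ?u ?v" using ij by (simp add: form_conformal form_y_y)
    also have "\<dots> = \<omega> ((\<Sum>l<n. \<omega> ?u (y l) *s x l) + (\<Sum>l<n. \<omega> (x l) ?u *s y l) + \<gamma> ?u *s z) ?v"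
      using \<gamma>[of ?u] by simp
    \<comment> \<open>The minus sign comes from turning \<open>\<omega> (y l) ?v\<close> into
      \<open>- \<omega> ?v (y l)\<close>; the two sums are the \<open>(i, j)\<close> entries of the
      two products.\<close>
    also have "\<dots> = (\<Sum>l<n. \<omega> ?u (y l) * \<omega> (x l) ?v) - (\<Sum>l<n. \<omega> (x l) ?u * \<omega> ?v (y l))"
      by (simp add: form_simps form_skew[of "y _" ?v] sum_negf)
    finally show "(transpose_mat T * Y) $$ (i, j) = (transpose_mat Y * T) $$ (i, j)"
      using ij by (simp add: T_def Y_def scalar_prod_def lessThan_atLeast0)
  qed (simp_all add: T_def Y_def)
  show ?thesis
    using mat XY TY by (intro exI[of _ X] exI[of _ T] exI[of _ Y] exI[of _ M])
      (simp add: P_def X_def T_def Y_def M_def)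
qed

end

text \<open>A longest hyperbolic system together with \<open>z\<close> is a basis; counting its
  \<open>2 * n + 1\<close> vectors forces \<open>n = m\<close>.\<close>

theorem conformal_normal_form:
  assumes dim: "dim UNIV = 2 * m + 1"
    and p: "p \<noteq> 0" "\<And>v. poly_of_map scale p \<alpha> v = 0"
    and c: "c \<noteq> 1 \<or> Polynomial.order c p = 1"
  obtains x y X T Y M where "hyperbolic m x y"
    and "ordered_basis scale (map x [0..<m] @ map y [0..<m] @ [z])"
    and "X \<in> carrier_mat m m" and "T \<in> carrier_mat m m" and "Y \<in> carrier_mat m m"
    and "M \<in> carrier_mat 1 m"
    and "matrix_of_map scale (map x [0..<m] @ map y [0..<m] @ [z]) \<alpha> = heisenberg_block_mat m X T Y M c"
    and "transpose_mat X * Y = c \<cdot>\<^sub>m 1\<^sub>m m" and "transpose_mat T * Y = transpose_mat Y * T"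
proof -
  \<comment> \<open>The maximum exists: the empty system is hyperbolic and the dimension bounds
    every length.\<close>
  define n where "n = (GREATEST n. \<exists>x y. hyperbolic n x y)"
  have 0: "\<exists>x y. hyperbolic 0 x y" by (auto simp: hyperbolic_def)
  have bound: "\<And>n. \<exists>x y. hyperbolic n x y \<Longrightarrow> n \<le> dim UNIV"
    using hyperbolic_le_dim dim by auto
  obtain x y where hyp: "hyperbolic n x y"
    using GreatestI_nat[where P = "\<lambda>n. \<exists>x y. hyperbolic n x y", OF 0 bound] unfolding n_def by blast
  have max: "\<nexists>x' y'. hyperbolic (Suc n) x' y'"
    using Greatest_le_nat[where P = "\<lambda>n. \<exists>x y. hyperbolic n x y", OF _ bound, of "Suc n"]
    unfolding n_def by fastforce
  note perp = maximal_hyperbolic_perp[OF hyp max p c]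
  have basis: "ordered_basis scale (map x [0..<n] @ map y [0..<n] @ [z])" (is "ordered_basis _ ?bs")
    using hyperbolic_ordered_basis[OF hyp perp] .
  have "dim UNIV = card (set ?bs)"
    using basis unfolding ordered_basis_def by (intro dim_eq_card) auto
  also have "\<dots> = length ?bs" using basis unfolding ordered_basis_def by (intro distinct_card) auto
  finally have "n = m" using dim by simp
  then show thesis
    using hyperbolic_block_form[OF hyp perp] hyp basis that by blast
qed

end

section \<open>Heisenberg Hom-Lie algebras\<close>

text \<open>The derived algebra is a line, so the bracket is a scalar multiple of its generator
  \<open>z\<close>. The identities for \<open>\<omega>\<close> follow from those of the bracket by
  cancelling \<open>z\<close>.\<close>

lemma heisenberg_conformal_form:
  fixes scale :: "complex \<Rightarrow> 'v::ab_group_add \<Rightarrow> 'v"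
  assumes "heisenberg_hom_lie_algebra scale br \<alpha>" and c: "c \<noteq> 0"
    and twist: "\<forall>u \<in> hom_lie_algebra.bracket scale br UNIV UNIV. \<alpha> u = scale c u"
  obtains \<omega> z where "conformal_form scale \<alpha> \<omega> z c" and "\<And>u v. br u v = scale (\<omega> u v) z"
    and "z \<in> hom_lie_algebra.center br"
proof -
  interpret heisenberg_hom_lie_algebra scale br \<alpha> by fact
  define D where "D = bracket UNIV UNIV"
  have "subspace D" by (simp add: D_def bracket_def)
  obtain Bs where Bs: "Bs \<subseteq> D" "independent Bs" "D \<subseteq> span Bs" "card Bs = dim D"
    by (rule basis_exists[of D])
  then obtain z where z: "Bs = {z}" using dim_derived by (auto simp: D_def card_1_singleton_iff)
  have z0: "z \<noteq> 0" using Bs dependent_zero by (auto simp: z)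
  have D: "D = span {z}" using Bs span_minimal[OF Bs(1) \<open>subspace D\<close>] unfolding z by blast
  have zD: "z \<in> D" using Bs by (simp add: z)
  have "br u v \<in> D" for u v unfolding D_def bracket_def by (rule span_base) auto
  then have "\<exists>t. br u v = scale t z" for u v by (auto simp: D span_singleton)
  then obtain \<omega> where \<omega>: "br u v = scale (\<omega> u v) z" for u v by metis
  have inj: "a = b" if "scale a z = scale b z" for a b using that z0 by simp
  interpret l: Vector_Spaces.linear scale scale "\<lambda>x. br x y" for y by (rule linear_br_left)
  have twist_z: "\<alpha> z = scale c z" using twist zD by (simp add: D_def)
  interpret tw: Vector_Spaces.linear scale scale \<alpha> by (rule linear_twist)
  have "conformal_form scale \<alpha> \<omega> z c"
  proof unfold_locales
    fix u v w a
    show "\<omega> (u + v) w = \<omega> u w + \<omega> v w"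
      using l.add[of u v w] by (intro inj) (simp add: \<omega> scale_left_distrib)
    show "\<omega> (scale a u) w = a * \<omega> u w"
      using l.scale[of a u w] by (intro inj) (simp add: \<omega>)
    show "\<omega> u v = - \<omega> v u"
      using br_skew[of u v] by (intro inj) (simp add: \<omega>)
    have "(\<forall>v. \<omega> u v = 0) \<longleftrightarrow> u \<in> center" using z0 by (simp add: center_def \<omega>)
    then show "(\<forall>v. \<omega> u v = 0) \<longleftrightarrow> u \<in> span {z}" using derived_eq_center D by (simp add: D_def)
    \<comment> \<open>Multiplicativity compares two multiples of \<open>z\<close>; the factor
      \<open>c\<close> arises from \<open>\<alpha> z = c z\<close>.\<close>
    have "\<alpha> (br u v) = br (\<alpha> u) (\<alpha> v)" using multiplicative unfolding multiplicative_def by blast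
    then have "scale (\<omega> (\<alpha> u) (\<alpha> v)) z = scale (c * \<omega> u v) z"
      by (simp add: \<omega> tw.scale twist_z mult.commute del: scale_cancel_right)
    then show "\<omega> (\<alpha> u) (\<alpha> v) = c * \<omega> u v" by (rule inj)
  qed (use z0 twist_z c in auto)
  then show thesis using that \<omega> zD derived_eq_center by (simp add: D_def)
qed

theorem corollary3p15:
  fixes scale :: "complex \<Rightarrow> 'v::ab_group_add \<Rightarrow> 'v"
    and br :: "'v \<Rightarrow> 'v \<Rightarrow> 'v"
    and \<alpha> :: "'v \<Rightarrow> 'v"
    and m k :: nat
    and c :: complex
    and p :: "complex poly"
  assumes "m \<ge> 1"
    and "c \<noteq> 0"
    and "heisenberg_hom_lie_algebra scale br \<alpha>"
    and "vector_space.dim scale (UNIV :: 'v set) = 2 * m + 1"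
    and "\<forall>u \<in> hom_lie_algebra.bracket scale br UNIV UNIV. \<alpha> u = scale c u"
    and "minimal_polynomial scale \<alpha> p"
    and "k = Polynomial.order c p"
    and "c \<noteq> 1 \<or> k = 1"
  shows "\<exists>(x :: nat \<Rightarrow> 'v) (y :: nat \<Rightarrow> 'v) (z :: 'v) X T Y M.
           ordered_basis scale (map x [0..<m] @ map y [0..<m] @ [z]) \<and>
           (\<forall>i<m. \<forall>j<m. br (x i) (y j) = (if i = j then z else 0)) \<and>
           (\<forall>i<m. \<forall>j<m. br (x i) (x j) = 0 \<and> br (y i) (y j) = 0) \<and>
           z \<in> hom_lie_algebra.center br \<and>
           X \<in> carrier_mat m m \<and> T \<in> carrier_mat m m \<and> Y \<in> carrier_mat m m \<and>
           M \<in> carrier_mat 1 m \<and>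
           matrix_of_map scale (map x [0..<m] @ map y [0..<m] @ [z]) \<alpha> =
             heisenberg_block_mat m X T Y M c \<and>
           transpose_mat X * Y = c \<cdot>\<^sub>m 1\<^sub>m m \<and>
           transpose_mat T * Y = transpose_mat Y * T"
proof -
  obtain \<omega> z where form: "conformal_form scale \<alpha> \<omega> z c" and br: "\<And>u v. br u v = scale (\<omega> u v) z"
    and z: "z \<in> hom_lie_algebra.center br"
    using heisenberg_conformal_form[OF assms(3,2,5)] by blast
  interpret conformal_form scale \<alpha> \<omega> z c by (rule form)
  have p: "p \<noteq> 0" "\<And>v. poly_of_map scale p \<alpha> v = 0"
    using assms(6) by (auto simp: minimal_polynomial_def)
  have c: "c \<noteq> 1 \<or> Polynomial.order c p = 1" using assms(7,8) by simp
  obtain x y X T Y M where hyp: "hyperbolic m x y"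
    and normal: "ordered_basis scale (map x [0..<m] @ map y [0..<m] @ [z])"
      "X \<in> carrier_mat m m" "T \<in> carrier_mat m m" "Y \<in> carrier_mat m m" "M \<in> carrier_mat 1 m"
      "matrix_of_map scale (map x [0..<m] @ map y [0..<m] @ [z]) \<alpha> = heisenberg_block_mat m X T Y M c"
      "transpose_mat X * Y = c \<cdot>\<^sub>m 1\<^sub>m m" "transpose_mat T * Y = transpose_mat Y * T"
    by (rule conformal_normal_form[OF assms(4) p c])
  have "\<forall>i<m. \<forall>j<m. br (x i) (y j) = (if i = j then z else 0)"
    using form_x_y[OF hyp] by (simp add: br)
  moreover have "\<forall>i<m. \<forall>j<m. br (x i) (x j) = 0 \<and> br (y i) (y j) = 0"
    using form_x_x[OF hyp] form_y_y[OF hyp] by (simp add: br)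
  ultimately show ?thesis using normal z by blast
qed

end
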